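(* Let $k$ be a positive integer that is not a perfect square, let $d$ be one of the two integers nearest to $\sqrt{k}$ (that is, $d=\lfloor\sqrt{k}\rfloor$ or $d=\lceil\sqrt{k}\rceil$), and let $f(x)=\dfrac{dx+k}{x+d}$. If $R=\dfrac{4d^2}{k-d^2}$ is an integer, then every iterate $f^n(\infty)$, $n\ge1$, is a semiconvergent of the continued fraction expansion of $\sqrt{k}$.
   Context: $f$ acts on $\mathbb{R}\cup\{\infty\}$ with $f(\infty)=d$, and $f^n$ is its $n$-fold composite. If $\sqrt{k}=[c_0;c_1,c_2,\dots]$ is the simple continued fraction expansion, a semiconvergent is a rational number of the form $[c_0;c_1,\dots,c_{n-1},b]$ with $n\ge0$ and $b$ an integer with $0\le b\le c_n$. *)

theory Defs
  imports Complex_Main "HOL-Computational_Algebra.Nth_Powers"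
begin

text \<open>
  The projective line \<open>\<real> \<union> {\<infinity>}\<close> is the type \<^typ>\<open>real option\<close>, with \<^term>\<open>None\<close> as \<open>\<infinity>\<close>.
\<close>

definition sqrt_map :: "real \<Rightarrow> real \<Rightarrow> real option \<Rightarrow> real option" where
  "sqrt_map d k z =
     (case z of
        None \<Rightarrow> Some d
      | Some x \<Rightarrow> if x + d = 0 then None else Some ((d * x + k) / (x + d)))"

text \<open>
  Complete quotients and partial quotients. They give the simple continued fraction expansion
  for irrational \<open>x\<close> only: for rational \<open>x\<close> the expansion should stop, whereas here it would
  continue with \<open>1 / 0 = 0\<close>.
\<close>

primrec cf_remainder :: "real \<Rightarrow> nat \<Rightarrow> real" where
  "cf_remainder x 0 = x"
| "cf_remainder x (Suc n) = 1 / (cf_remainder x n - of_int \<lfloor>cf_remainder x n\<rfloor>)"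

definition cf_coeff :: "real \<Rightarrow> nat \<Rightarrow> int" where
  "cf_coeff x n = \<lfloor>cf_remainder x n\<rfloor>"

text \<open>
  The value \<open>[a\<^sub>0; a\<^sub>1, \<dots>, a\<^sub>m]\<close>, computed in \<open>\<real> \<union> {\<infinity>}\<close> with \<open>1 / 0 = \<infinity>\<close>, \<open>1 / \<infinity> = 0\<close> and
  \<open>a + \<infinity> = \<infinity>\<close>, so that a last entry \<open>0\<close> is meaningful:
  \<open>[a\<^sub>0; \<dots>, a\<^sub>m, b, 0] = [a\<^sub>0; \<dots>, a\<^sub>m]\<close>. The empty list has value \<open>\<infinity>\<close>, which makes
  \<open>[a\<^sub>0] = a\<^sub>0\<close> an instance of the recursion.
\<close>

primrec cf_value :: "int list \<Rightarrow> real option" where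
  "cf_value [] = None"
| "cf_value (a # as) =
     (case cf_value as of
        None \<Rightarrow> Some (of_int a)
      | Some y \<Rightarrow> if y = 0 then None else Some (of_int a + 1 / y))"

definition semiconvergent :: "real \<Rightarrow> real \<Rightarrow> bool" where
  "semiconvergent x r \<longleftrightarrow>
     r \<in> \<rat> \<and>
     (\<exists>n b. 0 \<le> b \<and> b \<le> cf_coeff x n \<and>
            cf_value (map (cf_coeff x) [0..<n] @ [b]) = Some r)"

end

theory Submission
  imports Defs
begin

text \<open>
  Write \<open>(d + \<surd>k)\<^sup>n = P + Q\<surd>k\<close>, so that \<open>f\<^sup>n(\<infinity>) = P/Q\<close>, and put \<open>e = k - d\<^sup>2\<close>. The unit
  \<open>\<alpha> = (d + \<surd>k)\<^sup>2 / e\<close> has norm \<open>1\<close> and trace \<open>R + 2\<close>; as \<open>R\<close> is an integer, \<open>\<gamma> \<alpha>\<^sup>m\<close> lies in \<open>\<int>[\<surd>k]\<close>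
  for all \<open>m\<close> once it does for two consecutive values of \<open>m\<close>. This applies to \<open>\<gamma> = d + \<surd>k\<close>, since
  \<open>\<alpha>\<^sup>-\<^sup>1(d + \<surd>k) = \<surd>k - d\<close>, and to the integer \<open>\<gamma> = |e| / gcd(e, 2d)\<close>, whose square is at most \<open>|e|\<close>.
  Hence \<open>f\<^sup>n(\<infinity>) = p/q\<close> for integers with \<open>|p\<^sup>2 - k q\<^sup>2| \<le> |e| \<le> 2\<lfloor>\<surd>k\<rfloor> < p/q + \<surd>k\<close>, that is
  \<open>|\<surd>k - p/q| < 1/q\<^sup>2\<close>, and such a fraction is a semiconvergent.
\<close>

section \<open>Convergents\<close>

text \<open>
  The indices are shifted by two: \<open>cf_num x (n + 2) / cf_den x (n + 2)\<close> is the convergent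
  \<open>[c\<^sub>0; \<dots>, c\<^sub>n]\<close>, and the indices \<open>0\<close>, \<open>1\<close> stand for the formal convergents \<open>0/1\<close>, \<open>1/0\<close>.
\<close>

fun cf_num :: "real \<Rightarrow> nat \<Rightarrow> int" where
  "cf_num x 0 = 0"
| "cf_num x (Suc 0) = 1"
| "cf_num x (Suc (Suc n)) = cf_coeff x n * cf_num x (Suc n) + cf_num x n"

fun cf_den :: "real \<Rightarrow> nat \<Rightarrow> int" where
  "cf_den x 0 = 1"
| "cf_den x (Suc 0) = 0"
| "cf_den x (Suc (Suc n)) = cf_coeff x n * cf_den x (Suc n) + cf_den x n"

lemma cf_num_den_det:
  "cf_num x (Suc n) * cf_den x n - cf_num x n * cf_den x (Suc n) = (- 1) ^ n"
proof (induction n)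
  case (Suc n)
  have "cf_num x (Suc (Suc n)) * cf_den x (Suc n) - cf_num x (Suc n) * cf_den x (Suc (Suc n))
      = - (cf_num x (Suc n) * cf_den x n - cf_num x n * cf_den x (Suc n))"
    by (simp add: algebra_simps)
  then show ?case
    using Suc.IH by simp
qed simp

lemma cf_value_Cons_fraction:
  fixes s t :: int
  assumes "cf_value ys = (if t = 0 then None else Some (of_int s / of_int t))"
    and "s \<noteq> 0 \<or> t \<noteq> 0"
  shows "cf_value (a # ys) =
           (if s = 0 then None else Some (of_int (a * s + t) / of_int s))"
  using assms by (auto simp: field_simps)

text \<open>The value of \<open>ys\<close> is kept in homogeneous coordinates \<open>s : t\<close>,
  with \<open>t = 0\<close> for infinity. The induction moves the last coefficient into the tail,
  hence \<open>ys\<close>, \<open>s\<close> and \<open>t\<close> vary.\<close>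

lemma cf_value_append_fraction:
  fixes s t :: int
  assumes "cf_value ys = (if t = 0 then None else Some (of_int s / of_int t))"
    and "s \<noteq> 0 \<or> t \<noteq> 0"
  shows "cf_value (map (cf_coeff x) [0..<m] @ ys) =
           (if s * cf_den x (Suc m) + t * cf_den x m = 0 then None
            else Some (of_int (s * cf_num x (Suc m) + t * cf_num x m) /
                       of_int (s * cf_den x (Suc m) + t * cf_den x m)))"
  using assms
proof (induction m arbitrary: ys s t)
  case (Suc m)
  let ?c = "cf_coeff x m"
  have *: "cf_value (?c # ys) =
      (if s = 0 then None else Some (of_int (?c * s + t) / of_int s))"
    using cf_value_Cons_fraction[OF Suc.prems] .
  have "?c * s + t \<noteq> 0 \<or> s \<noteq> 0"
    using Suc.prems(2) by auto
  from Suc.IH[OF * this] show ?case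
    by (simp add: algebra_simps)
qed simp

lemma cf_remainder_irrational:
  assumes "x \<notin> \<rat>"
  shows "cf_remainder x n \<notin> \<rat>"
proof (induction n)
  case (Suc n)
  let ?y = "cf_remainder x n"
  show ?case
  proof
    assume "cf_remainder x (Suc n) \<in> \<rat>"
    then have "inverse (1 / (?y - of_int \<lfloor>?y\<rfloor>)) + of_int \<lfloor>?y\<rfloor> \<in> \<rat>"
      by (intro Rats_add Rats_inverse Rats_of_int) simp
    then show False
      using Suc.IH by simp
  qed
qed (use assms in simp)

lemma cf_remainder_fraction_pos:
  assumes "x \<notin> \<rat>"
  shows "cf_remainder x n > of_int (cf_coeff x n)"
proof -
  have "cf_remainder x n \<noteq> of_int \<lfloor>cf_remainder x n\<rfloor>"
    by (metis Rats_of_int assms cf_remainder_irrational)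
  then show ?thesis
    unfolding cf_coeff_def using of_int_floor_le[of "cf_remainder x n"] by linarith
qed

lemma cf_remainder_gt_1:
  assumes "x \<notin> \<rat>"
  shows "cf_remainder x (Suc n) > 1"
proof -
  have "cf_remainder x n - of_int \<lfloor>cf_remainder x n\<rfloor> < 1"
    by linarith
  then show ?thesis
    using cf_remainder_fraction_pos[OF assms, of n] by (simp add: cf_coeff_def)
qed

lemma cf_coeff_ge_1:
  assumes "x \<notin> \<rat>"
  shows "cf_coeff x (Suc n) \<ge> 1"
  using cf_remainder_gt_1[OF assms, of n] unfolding cf_coeff_def by linarith

text \<open>Replacing the tail of the expansion by the complete quotient
  \<open>cf_remainder x n\<close> gives back \<open>x\<close>; here the denominators are
  cleared.\<close>

lemma cf_remainder_num_den:
  assumes "x \<notin> \<rat>"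
  shows "x * (cf_remainder x n * of_int (cf_den x (Suc n)) + of_int (cf_den x n)) =
         cf_remainder x n * of_int (cf_num x (Suc n)) + of_int (cf_num x n)"
proof (induction n)
  case (Suc n)
  define y z where "y = cf_remainder x n" and "z = cf_remainder x (Suc n)"
  have "z = 1 / (y - of_int (cf_coeff x n))"
    by (simp add: y_def z_def cf_coeff_def)
  moreover have "y - of_int (cf_coeff x n) > 0"
    using cf_remainder_fraction_pos[OF assms, of n] unfolding y_def by simp
  ultimately have y: "y * z = of_int (cf_coeff x n) * z + 1"
    by (simp add: divide_simps) (simp add: algebra_simps)
  have "z * (x * (y * of_int (cf_den x (Suc n)) + of_int (cf_den x n))) =
        z * (y * of_int (cf_num x (Suc n)) + of_int (cf_num x n))"
    using Suc.IH unfolding y_def by simp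
  then have "x * ((y * z) * of_int (cf_den x (Suc n)) + z * of_int (cf_den x n)) =
        (y * z) * of_int (cf_num x (Suc n)) + z * of_int (cf_num x n)"
    by (simp add: algebra_simps)
  then show ?case
    unfolding y z_def[symmetric] by (simp add: algebra_simps)
qed simp

lemma cf_den_mono:
  assumes "x \<notin> \<rat>"
  shows "0 \<le> cf_den x (Suc n) \<and> cf_den x (Suc n) \<le> cf_den x (Suc (Suc n)) \<and>
         1 \<le> cf_den x (Suc (Suc n))"
proof (induction n)
  case (Suc n)
  have "1 * cf_den x (Suc (Suc n)) \<le> cf_coeff x (Suc n) * cf_den x (Suc (Suc n))"
    using cf_coeff_ge_1[OF assms, of n] Suc.IH by (intro mult_right_mono) auto
  then show ?case
    using Suc.IH unfolding cf_den.simps(3)[of x "Suc n"] by linarith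
qed simp

text \<open>Crude linear growth, enough to make the denominators unbounded: of the two preceding
  denominators, the nearer one supplies \<open>n - 1\<close> and the other at least 1.\<close>

lemma cf_den_ge:
  assumes "x \<notin> \<rat>"
  shows "int n \<le> cf_den x (Suc (Suc n))"
proof (induction n rule: less_induct)
  case (less n)
  consider "n = 0" | "n = 1" | m where "n = Suc (Suc m)"
    by (metis One_nat_def not0_implies_Suc)
  then show ?case
  proof cases
    case 3
    let ?B = "cf_den x"
    have "1 * ?B (Suc (Suc (Suc m))) \<le> cf_coeff x (Suc (Suc m)) * ?B (Suc (Suc (Suc m)))"
      using cf_coeff_ge_1[OF assms, of "Suc m"] cf_den_mono[OF assms, of "Suc m"]
      by (intro mult_right_mono) auto
    moreover have "int (Suc m) \<le> ?B (Suc (Suc (Suc m)))"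
      using less[of "Suc m"] 3 by simp
    moreover have "1 \<le> ?B (Suc (Suc m))"
      using cf_den_mono[OF assms] by blast
    ultimately show ?thesis
      unfolding 3 cf_den.simps(3)[of x "Suc (Suc m)"] by linarith
  qed (use cf_den_mono[OF assms, of 0] cf_den_mono[OF assms, of 1] in auto)
qed

section \<open>Fatou's criterion\<close>

lemma cf_den_bracket:
  assumes "x \<notin> \<rat>" and "q \<ge> 1"
  obtains m where "cf_den x (Suc (Suc m)) \<le> q" and "q < cf_den x (Suc (Suc (Suc m)))"
proof -
  define j where "j = (LEAST j. q < cf_den x j)"
  have "q < cf_den x (Suc (Suc (Suc (nat q))))"
    using cf_den_ge[OF assms(1), of "Suc (nat q)"] assms(2) by simp
  then have j: "q < cf_den x j"
    unfolding j_def by (rule LeastI)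
  have below: "cf_den x i \<le> q" if "i < j" for i
    using not_less_Least[of i "\<lambda>j. q < cf_den x j"] that unfolding j_def by simp
  \<comment> \<open>The denominators at the indices 0, 1, 2 are 1, 0, 1, none of which exceeds
    \<open>q\<close>.\<close>
  have "j \<noteq> 0" "j \<noteq> 1" "j \<noteq> 2"
    using j assms(2) cf_den.simps(1)[of x] by (metis not_le, auto simp: numeral_2_eq_2)
  then obtain m where "j = Suc (Suc (Suc m))"
    by (metis One_nat_def numeral_2_eq_2 not0_implies_Suc)
  with j below[of "Suc (Suc m)"] show thesis
    by (intro that[of m]) (simp_all del: cf_den.simps)
qed

text \<open>
  Here \<open>u\<close>, \<open>v\<close> are the coordinates of \<open>(p, q)\<close> with respect to two consecutive convergents with
  denominators \<open>k' \<le> k\<close>, and \<open>|q x - p| = |u - v X| / (X k + k')\<close> for the complete quotient \<open>X\<close>.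
\<close>

lemma semiconvergent_coordinates:
  fixes u v k k' c q :: int and X :: real
  assumes q: "q = u * k + v * k'" "k \<le> q" "q < c * k + k'"
    and k: "0 \<le> k'" "k' \<le> k" "1 \<le> k"
    and X: "1 < X" "of_int c \<le> X"
    and bound: "\<bar>of_int u - of_int v * X\<bar> * of_int q < X * of_int k + of_int k'"
  shows "v = 0 \<and> u > 0 \<or> v = 1 \<and> 0 \<le> u \<and> u \<le> c"
proof -
  \<comment> \<open>As \<open>k' \<le> k \<le> q\<close>, a distance of \<open>X + 1\<close> or more
    violates \<open>bound\<close>; \<open>2 * X\<close> exceeds \<open>X + 1\<close> because
    \<open>X > 1\<close>.\<close>
  have large: False
    if "\<bar>of_int u - of_int v * X\<bar> \<ge> 2 * X \<or> \<bar>of_int u - of_int v * X\<bar> \<ge> X + 1"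
  proof -
    have "X + 1 \<le> \<bar>of_int u - of_int v * X\<bar>"
      using that X by auto
    then have "(X + 1) * of_int k \<le> \<bar>of_int u - of_int v * X\<bar> * of_int q"
      using q(2) k X by (intro mult_mono) auto
    moreover have "X * of_int k + of_int k' \<le> (X + 1) * of_int k"
      using k by (simp add: algebra_simps)
    ultimately show False
      using bound by linarith
  qed
  consider "v \<le> -1" | "v = 0" | "v = 1" | "v \<ge> 2"
    by linarith
  then show ?thesis
  proof cases
    case 1
    have "v * k' \<le> 0"
      using 1 k by (simp add: mult_nonpos_nonneg)
    then have "u * k > 0"
      using q k by linarith
    then have "u \<ge> 1"
      using k by (simp add: zero_less_mult_iff)
    have "1 * X \<le> of_int (- v) * X"
      using 1 X by (intro mult_right_mono) auto
    then have "\<bar>of_int u - of_int v * X\<bar> \<ge> X + 1"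
      using \<open>u \<ge> 1\<close> X by simp
    then show ?thesis
      using large by blast
  next
    case 2
    have "u * k > 0"
      using q k 2 by simp
    then have "u > 0"
      using k by (simp add: zero_less_mult_iff)
    then show ?thesis
      using 2 by simp
  next
    case 3
    have "u * k < c * k"
      using q 3 by simp
    then have "u < c"
      using k by simp
    moreover have "u \<ge> 0"
    proof (rule ccontr)
      assume "\<not> u \<ge> 0"
      then have "u * k \<le> -1 * k"
        using k by (intro mult_right_mono) auto
      then show False
        using q k 3 by simp
    qed
    ultimately show ?thesis
      using 3 by simp
  next
    case 4
    have vX: "2 * X \<le> of_int v * X"
      using 4 X by (intro mult_right_mono) auto
    show ?thesis
    proof (cases "u \<le> 0")
      case True
      then have "real_of_int u \<le> 0"
        by simp
      then have "\<bar>of_int u - of_int v * X\<bar> \<ge> 2 * X"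
        using vX X by linarith
      then show ?thesis
        using large by blast
    next
      case False
      \<comment> \<open>For positive \<open>u\<close> the distance is only known to be at least
        \<open>X\<close>, but now \<open>q\<close> is at least \<open>k + k'\<close>, and
        \<open>X * (k + k') \<ge> X * k + k'\<close> still contradicts \<open>bound\<close>.\<close>
      have vk: "2 * k' \<le> v * k'"
        using 4 k by (intro mult_right_mono) auto
      then have "u * k < c * k"
        using q k by linarith
      then have "u < c"
        using k by simp
      then have "real_of_int u < X"
        using X by linarith
      then have X_le: "X \<le> \<bar>of_int u - of_int v * X\<bar>"
        using vX by linarith
      have "1 * k \<le> u * k"
        using False k by (intro mult_right_mono) auto
      then have "k + k' \<le> q"
        using q vk k by linarith
      then have "X * of_int (k + k') \<le> \<bar>of_int u - of_int v * X\<bar> * of_int q"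
        using X X_le k by (intro mult_mono) auto
      moreover have "1 * real_of_int k' \<le> X * of_int k'"
        using X k by (intro mult_right_mono) auto
      ultimately show ?thesis
        using bound by (simp add: algebra_simps)
    qed
  qed
qed

text \<open>Cramer's rule; the determinant \<epsilon> is its own inverse.\<close>

lemma unimodular_coordinates:
  fixes a b c d p q :: int
  assumes "\<bar>a * d - b * c\<bar> = 1"
  obtains u v where "p = u * a + v * b" and "q = u * c + v * d"
proof -
  define \<epsilon> where "\<epsilon> = a * d - b * c"
  have \<epsilon>: "\<epsilon> * \<epsilon> = 1"
    using assms unfolding \<epsilon>_def by (metis abs_mult_self_eq mult_1)
  show thesis
  proof
    have "p = (\<epsilon> * \<epsilon>) * p" "q = (\<epsilon> * \<epsilon>) * q"
      using \<epsilon> by auto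
    then show "p = (\<epsilon> * (p * d - q * b)) * a + (\<epsilon> * (q * a - p * c)) * b"
      and "q = (\<epsilon> * (p * d - q * b)) * c + (\<epsilon> * (q * a - p * c)) * d"
      unfolding \<epsilon>_def by (simp_all add: algebra_simps)
  qed
qed

text \<open>Expand \<open>(p, q)\<close> in two consecutive convergents such that \<open>q\<close>
  lies between the denominator \<open>k\<close> and the next one. The coordinate
  \<open>v = 0\<close> yields the convergent \<open>h/k\<close>, and \<open>v = 1\<close> the
  fraction with last entry \<open>u\<close>.\<close>

theorem semiconvergent_if_close:
  fixes p q :: int
  assumes irr: "x \<notin> \<rat>" and "x > 0" and "q \<ge> 1"
    and close: "\<bar>of_int q * x - of_int p\<bar> * of_int q < 1"
  shows "semiconvergent x (of_int p / of_int q)"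
proof -
  obtain m where m: "cf_den x (Suc (Suc m)) \<le> q" "q < cf_den x (Suc (Suc (Suc m)))"
    using cf_den_bracket[OF irr \<open>q \<ge> 1\<close>] .
  define h h' k k' where "h = cf_num x (Suc (Suc m))" and "h' = cf_num x (Suc m)"
    and "k = cf_den x (Suc (Suc m))" and "k' = cf_den x (Suc m)"
  define X where "X = cf_remainder x (Suc m)"
  define c where "c = cf_coeff x (Suc m)"
  have det: "\<bar>h * k' - h' * k\<bar> = 1"
    using cf_num_den_det[of x "Suc m"] unfolding h_def h'_def k_def k'_def by simp
  then obtain u v where u: "p = u * h + v * h'" and v: "q = u * k + v * k'"
    by (rule unimodular_coordinates)
  have k: "0 \<le> k'" "k' \<le> k" "1 \<le> k"
    using cf_den_mono[OF irr, of m] unfolding k_def k'_def by auto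
  have X: "1 < X" "of_int c \<le> X"
    using cf_remainder_gt_1[OF irr, of m] cf_remainder_fraction_pos[OF irr, of "Suc m"]
    unfolding X_def c_def by auto
  have pos: "X * of_int k + of_int k' > 0"
    using k X by (intro add_pos_nonneg mult_pos_pos) auto
  have x: "x * (X * of_int k + of_int k') = X * of_int h + of_int h'"
    using cf_remainder_num_den[OF irr, of "Suc m"]
    unfolding h_def h'_def k_def k'_def X_def by simp
  \<comment> \<open>Substituting the expression of \<open>x\<close> in terms of \<open>X\<close>
    leaves \<open>u - v * X\<close> times a determinant of absolute value 1; this turns
    \<open>close\<close> into the bound on the coordinates.\<close>
  have "(of_int q * x - of_int p) * (X * of_int k + of_int k') =
        of_int q * (x * (X * of_int k + of_int k')) - of_int p * (X * of_int k + of_int k')"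
    by (simp add: algebra_simps)
  also have "\<dots> = - ((of_int u - of_int v * X) * of_int (h * k' - h' * k))"
    unfolding x u v by (simp add: algebra_simps)
  finally have "\<bar>of_int q * x - of_int p\<bar> * (X * of_int k + of_int k') =
      \<bar>of_int u - of_int v * X\<bar> * of_int \<bar>h * k' - h' * k\<bar>"
    using pos by (metis abs_minus_cancel abs_mult abs_of_pos of_int_abs)
  then have "\<bar>of_int u - of_int v * X\<bar> * of_int q =
      (\<bar>of_int q * x - of_int p\<bar> * of_int q) * (X * of_int k + of_int k')"
    unfolding det by (simp add: algebra_simps)
  also have "\<dots> < 1 * (X * of_int k + of_int k')"
    using close pos by (intro mult_strict_right_mono)
  finally have bound: "\<bar>of_int u - of_int v * X\<bar> * of_int q < X * of_int k + of_int k'"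
    by simp
  have "q < c * k + k'"
    using m(2) unfolding c_def k_def k'_def by simp
  from semiconvergent_coordinates[OF v _ this k X bound] m(1)
  consider "v = 0" "u > 0" | "v = 1" "0 \<le> u" "u \<le> c"
    unfolding k_def by blast
  then show ?thesis
  proof cases
    case 1
    \<comment> \<open>The empty tail is infinity, that is \<open>1 : 0\<close>, and yields
      \<open>h/k\<close>; the common factor \<open>u\<close> of \<open>p\<close> and
      \<open>q\<close> cancels.\<close>
    have "cf_value (map (cf_coeff x) [0..<Suc m] @ []) = Some (of_int h / of_int k)"
      using cf_value_append_fraction[of "[]" 0 1 x "Suc m"] k unfolding h_def k_def by simp
    moreover have "real_of_int p / of_int q = of_int h / of_int k"
      using 1 u v by simp
    \<comment> \<open>The coefficient at index 0 is not covered by \<open>cf_coeff_ge_1\<close>; it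
      is nonnegative because \<open>x > 0\<close>.\<close>
    moreover have "0 \<le> cf_coeff x m"
      using \<open>x > 0\<close> cf_coeff_ge_1[OF irr] by (cases m) (auto simp: cf_coeff_def intro: order_trans)
    ultimately show ?thesis
      unfolding semiconvergent_def by (intro conjI exI[of _ m] exI[of _ "cf_coeff x m"]) auto
  next
    case 2
    have "cf_value (map (cf_coeff x) [0..<Suc m] @ [u]) = Some (of_int p / of_int q)"
      using cf_value_append_fraction[of "[u]" 1 u x "Suc m"] 2 u v \<open>q \<ge> 1\<close>
      unfolding h_def k_def h'_def k'_def by auto
    then show ?thesis
      using 2 unfolding semiconvergent_def c_def
      by (intro conjI exI[of _ "Suc m"] exI[of _ u]) auto
  qed
qed

section \<open>Powers of \<open>d + \<surd>k\<close>\<close>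

text \<open>\<open>(d + \<surd>k)\<^sup>n = pow_rat d k n + pow_irr d k n * \<surd>k\<close>\<close>

fun pow_rat :: "int \<Rightarrow> int \<Rightarrow> nat \<Rightarrow> int" and pow_irr :: "int \<Rightarrow> int \<Rightarrow> nat \<Rightarrow> int" where
  "pow_rat d k 0 = 1"
| "pow_rat d k (Suc n) = d * pow_rat d k n + k * pow_irr d k n"
| "pow_irr d k 0 = 0"
| "pow_irr d k (Suc n) = pow_rat d k n + d * pow_irr d k n"

lemma pow_norm: "(pow_rat d k n)\<^sup>2 - k * (pow_irr d k n)\<^sup>2 = (d\<^sup>2 - k) ^ n"
proof (induction n)
  case (Suc n)
  have "(pow_rat d k (Suc n))\<^sup>2 - k * (pow_irr d k (Suc n))\<^sup>2 =
        (d\<^sup>2 - k) * ((pow_rat d k n)\<^sup>2 - k * (pow_irr d k n)\<^sup>2)"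
    by (simp add: algebra_simps power2_eq_square)
  then show ?case
    using Suc.IH by simp
qed simp

text \<open>The square of \<open>d + \<surd>k\<close> has trace
  \<open>2 * (d^2 + k) = 4 * d^2 + 2 * e\<close> and norm \<open>e^2\<close>.\<close>

lemma pow_step_four:
  fixes d k :: int
  defines "e \<equiv> k - d\<^sup>2"
  shows "pow_rat d k (n + 4) = (4 * d\<^sup>2 + 2 * e) * pow_rat d k (n + 2) - e\<^sup>2 * pow_rat d k n"
    and "pow_irr d k (n + 4) = (4 * d\<^sup>2 + 2 * e) * pow_irr d k (n + 2) - e\<^sup>2 * pow_irr d k n"
  unfolding e_def by (simp_all add: numeral_eq_Suc algebra_simps)

lemma pow_pos:
  assumes "d \<ge> 1" and "k \<ge> 1"
  shows "pow_rat d k n \<ge> 1" and "pow_irr d k (Suc n) \<ge> 1"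
proof -
  have *: "pow_rat d k n \<ge> 1 \<and> pow_irr d k n \<ge> 0" for n
  proof (induction n)
    case (Suc n)
    have "1 * 1 \<le> d * pow_rat d k n"
      using assms Suc.IH by (intro mult_mono) auto
    moreover have "k * pow_irr d k n \<ge> 0" "d * pow_irr d k n \<ge> 0"
      using assms Suc.IH by auto
    ultimately show ?case
      using Suc.IH by simp
  qed simp
  then show "pow_rat d k n \<ge> 1"
    by blast
  have "d * pow_irr d k n \<ge> 0"
    using assms * by simp
  then show "pow_irr d k (Suc n) \<ge> 1"
    using *[of n] by simp
qed

text \<open>On homogeneous coordinates \<open>P : Q\<close> the map multiplies
  \<open>P + Q * \<surd>k\<close> by \<open>d + \<surd>k\<close>, and infinity is
  \<open>1 : 0\<close>. Positivity keeps the orbit away from the pole \<open>-d\<close>.\<close>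

lemma sqrt_map_iterate:
  fixes d k :: int
  assumes "d \<ge> 1" and "k \<ge> 1"
  shows "(sqrt_map (of_int d) (of_int k) ^^ Suc n) None =
         Some (of_int (pow_rat d k (Suc n)) / of_int (pow_irr d k (Suc n)))"
proof (induction n)
  case (Suc n)
  define P Q where "P = real_of_int (pow_rat d k (Suc n))"
    and "Q = real_of_int (pow_irr d k (Suc n))"
  have pos: "P > 0" "Q > 0"
    using pow_pos(1)[OF assms, of "Suc n"] pow_pos(2)[OF assms, of n]
    unfolding P_def Q_def by linarith+
  have next_PQ: "pow_rat d k (Suc (Suc n)) = of_int d * P + of_int k * Q"
    "pow_irr d k (Suc (Suc n)) = P + of_int d * Q"
    unfolding P_def Q_def by simp_all
  have "P / Q + of_int d > 0"
    using pos assms by (intro add_pos_pos) auto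
  moreover have "of_int d * (P / Q) + of_int k = (of_int d * P + of_int k * Q) / Q"
    "P / Q + of_int d = (P + of_int d * Q) / Q"
    using pos by (simp_all add: field_simps)
  then have "(of_int d * (P / Q) + of_int k) / (P / Q + of_int d) =
      (of_int d * P + of_int k * Q) / (P + of_int d * Q)"
    using pos by simp
  ultimately have "sqrt_map (of_int d) (of_int k) (Some (P / Q)) =
      Some ((of_int d * P + of_int k * Q) / (P + of_int d * Q))"
    by (simp add: sqrt_map_def)
  then show ?case
    unfolding next_PQ funpow.simps(2)[of "Suc n"] o_apply Suc.IH P_def Q_def .
qed (simp add: sqrt_map_def)

text \<open>The map sends \<open>[h, \<infinity>]\<close> into itself. Without denominators the
  bound also covers \<open>n = 0\<close>, where the ratio is \<open>1 : 0\<close>.\<close>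

lemma pow_ratio_ge:
  assumes "h \<ge> 0" and "d = h \<or> d = h + 1" and "h\<^sup>2 < k"
  shows "h * pow_irr d k n \<le> pow_rat d k n \<and> 0 \<le> pow_irr d k n"
proof (induction n)
  case (Suc n)
  let ?P = "pow_rat d k n" and ?Q = "pow_irr d k n"
  have IH: "h * ?Q \<le> ?P" "0 \<le> ?Q"
    using Suc.IH by auto
  have "0 \<le> h * ?Q"
    using IH assms(1) by simp
  then have "0 \<le> ?P"
    using IH by linarith
  have "0 \<le> d * ?Q"
    using IH assms by auto
  \<comment> \<open>The sides to be compared differ by
    \<open>(d - h) * ?P + (k - h * d) * ?Q\<close>. For \<open>d = h + 1\<close> the second
    coefficient may be negative, but \<open>?P \<ge> h * ?Q\<close> leaves at least
    \<open>(k - h^2) * ?Q\<close>.\<close>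
  have "(h\<^sup>2 + 1) * ?Q \<le> k * ?Q"
    using assms IH by (intro mult_right_mono) auto
  then have "h * (?P + d * ?Q) \<le> d * ?P + k * ?Q"
    using assms(2) IH by (auto simp: algebra_simps power2_eq_square)
  then show ?case
    using \<open>0 \<le> ?P\<close> \<open>0 \<le> d * ?Q\<close> by simp
qed simp

section \<open>Divisibility by powers of \<open>k - d^2\<close>\<close>

text \<open>
  Dividing \<open>a m\<close> by \<open>e\<^sup>m\<close> turns the recurrence into one with the integer coefficients \<open>s / e\<close>
  and \<open>-1\<close>; for \<open>s = 4d\<^sup>2 + 2e\<close> the former is \<open>R + 2\<close>.
\<close>

lemma power_dvd_recurrence:
  fixes e s :: int and a :: "nat \<Rightarrow> int"
  assumes "e dvd s" and "e dvd a 1"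
    and rec: "\<And>m. a (Suc (Suc m)) = s * a (Suc m) - e\<^sup>2 * a m"
  shows "e ^ m dvd a m \<and> e ^ Suc m dvd a (Suc m)"
proof (induction m)
  case (Suc m)
  have "e * e ^ Suc m dvd s * a (Suc m)"
    using Suc.IH assms(1) by (intro mult_dvd_mono) auto
  moreover have "e\<^sup>2 * e ^ m dvd e\<^sup>2 * a m"
    using Suc.IH by (intro mult_dvd_mono) auto
  ultimately have "e ^ Suc (Suc m) dvd a (Suc (Suc m))"
    unfolding rec by (intro dvd_diff) (simp_all add: power2_eq_square mult.assoc)
  then show ?case
    using Suc.IH by blast
qed (use assms in simp)

text \<open>The recurrence runs over exponents of one parity. Its start at \<open>m = 0\<close> is
  trivial, so the exponent \<open>i + 2\<close> decides.\<close>

lemma pow_dvd: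
  fixes c d k :: int
  assumes e: "k - d\<^sup>2 dvd 4 * d\<^sup>2"
    and base: "k - d\<^sup>2 dvd c * pow_rat d k (i + 2)" "k - d\<^sup>2 dvd c * pow_irr d k (i + 2)"
  shows "(k - d\<^sup>2) ^ m dvd c * pow_rat d k (i + 2 * m)"
    and "(k - d\<^sup>2) ^ m dvd c * pow_irr d k (i + 2 * m)"
proof -
  define e where "e = k - d\<^sup>2"
  have s: "e dvd 4 * d\<^sup>2 + 2 * e"
    using e unfolding e_def by (rule dvd_add[OF _ dvd_triv_right])
  have index: "i + 2 * Suc (Suc m) = (i + 2 * m) + 4" "i + 2 * Suc m = (i + 2 * m) + 2" for m
    by auto
  show "(k - d\<^sup>2) ^ m dvd c * pow_rat d k (i + 2 * m)"
    unfolding e_def[symmetric]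
  proof (rule power_dvd_recurrence[THEN conjunct1, OF s])
    show "c * pow_rat d k (i + 2 * Suc (Suc m)) =
        (4 * d\<^sup>2 + 2 * e) * (c * pow_rat d k (i + 2 * Suc m)) - e\<^sup>2 * (c * pow_rat d k (i + 2 * m))"
      for m unfolding index(1) unfolding index(2) pow_step_four e_def[symmetric]
      by (simp only: right_diff_distrib mult.left_commute)
  qed (use base in \<open>simp add: e_def\<close>)
  show "(k - d\<^sup>2) ^ m dvd c * pow_irr d k (i + 2 * m)"
    unfolding e_def[symmetric]
  proof (rule power_dvd_recurrence[THEN conjunct1, OF s])
    show "c * pow_irr d k (i + 2 * Suc (Suc m)) =
        (4 * d\<^sup>2 + 2 * e) * (c * pow_irr d k (i + 2 * Suc m)) - e\<^sup>2 * (c * pow_irr d k (i + 2 * m))"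
      for m unfolding index(1) unfolding index(2) pow_step_four e_def[symmetric]
      by (simp only: right_diff_distrib mult.left_commute)
  qed (use base in \<open>simp add: e_def\<close>)
qed

text \<open>With \<open>e = k - d^2\<close>, the cube of \<open>d + \<surd>k\<close> has the
  coordinates \<open>d * (4 * d^2 + 3 * e)\<close> and \<open>4 * d^2 + e\<close>, both multiples of
  \<open>e\<close>.\<close>

lemma pow_odd_dvd:
  fixes d k :: int
  assumes "k - d\<^sup>2 dvd 4 * d\<^sup>2"
  shows "(k - d\<^sup>2) ^ m dvd pow_rat d k (1 + 2 * m)"
    and "(k - d\<^sup>2) ^ m dvd pow_irr d k (1 + 2 * m)"
proof -
  have "pow_rat d k (1 + 2) = (4 * d\<^sup>2) * d + (k - d\<^sup>2) * (3 * d)"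
    "pow_irr d k (1 + 2) = (4 * d\<^sup>2) + (k - d\<^sup>2)"
    by (simp_all add: numeral_eq_Suc algebra_simps)
  then have "k - d\<^sup>2 dvd 1 * pow_rat d k (1 + 2)" "k - d\<^sup>2 dvd 1 * pow_irr d k (1 + 2)"
    using assms by (simp_all only: mult_1 dvd_add dvd_mult2 dvd_triv_left dvd_refl)
  from pow_dvd[OF assms this]
  show "(k - d\<^sup>2) ^ m dvd pow_rat d k (1 + 2 * m)"
    and "(k - d\<^sup>2) ^ m dvd pow_irr d k (1 + 2 * m)"
    by simp_all
qed

text \<open>The square of \<open>d + \<surd>k\<close> is
  \<open>2 * d^2 + e + 2 * d * \<surd>k\<close> with \<open>e = k - d^2\<close>, so it suffices that
  \<open>c\<close> clears \<open>2 * d\<close> modulo \<open>e\<close>.\<close>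

lemma pow_even_dvd:
  fixes c d k :: int
  assumes "k - d\<^sup>2 dvd 4 * d\<^sup>2" and "k - d\<^sup>2 dvd c * (2 * d)"
  shows "(k - d\<^sup>2) ^ m dvd c * pow_rat d k (2 * m)"
    and "(k - d\<^sup>2) ^ m dvd c * pow_irr d k (2 * m)"
proof -
  have "c * pow_rat d k (0 + 2) = (c * (2 * d)) * d + (k - d\<^sup>2) * c"
    "c * pow_irr d k (0 + 2) = c * (2 * d)"
    by (simp_all add: numeral_eq_Suc algebra_simps)
  then have "k - d\<^sup>2 dvd c * pow_rat d k (0 + 2)" "k - d\<^sup>2 dvd c * pow_irr d k (0 + 2)"
    using assms(2) by (simp_all only: dvd_add dvd_mult2 dvd_triv_left)
  from pow_dvd[OF assms(1) this]
  show "(k - d\<^sup>2) ^ m dvd c * pow_rat d k (2 * m)"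
    and "(k - d\<^sup>2) ^ m dvd c * pow_irr d k (2 * m)"
    by simp_all
qed

text \<open>Take \<open>c = e / g\<close> with \<open>g = gcd e a\<close>. Then \<open>e\<close>
  divides \<open>g^2\<close>, so \<open>c\<close> divides \<open>g\<close> and
  \<open>c^2 \<le> g * |c| = |e|\<close>.\<close>

lemma obtain_small_cofactor:
  fixes e a :: int
  assumes "e \<noteq> 0" and "e dvd a\<^sup>2"
  obtains c where "c \<noteq> 0" and "c\<^sup>2 \<le> \<bar>e\<bar>" and "e dvd c * a"
proof -
  define g where "g = gcd e a"
  have "g > 0"
    using assms(1) unfolding g_def by simp
  obtain c where c: "e = g * c"
    unfolding g_def by (meson dvdE gcd_dvd1)
  have "e dvd gcd (e\<^sup>2) (a\<^sup>2)"
    using assms(2) by (intro gcd_greatest) simp_all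
  also have "gcd (e\<^sup>2) (a\<^sup>2) = g * g"
    unfolding g_def power2_eq_square[of "gcd e a", symmetric] by (rule gcd_exp)
  finally have "g * c dvd g * g"
    unfolding c .
  then have "c dvd g"
    using \<open>g > 0\<close> by simp
  then have "\<bar>c\<bar> \<le> g"
    using \<open>g > 0\<close> dvd_imp_le_int[of g c] by simp
  then have "\<bar>c\<bar> * \<bar>c\<bar> \<le> g * \<bar>c\<bar>"
    by (intro mult_right_mono) auto
  then have "c\<^sup>2 \<le> \<bar>e\<bar>"
    using \<open>g > 0\<close> unfolding c by (simp add: abs_mult power2_eq_square)
  moreover have "e dvd c * a"
    unfolding c by (metis dvd_refl g_def gcd_dvd2 mult.commute mult_dvd_mono)
  moreover have "c \<noteq> 0"
    using c assms(1) by auto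
  ultimately show thesis
    by (intro that)
qed

text \<open>Let \<open>m = n div 2\<close>. Dividing \<open>b * (P + Q * \<surd>k)\<close> by
  \<open>e^m\<close> gives \<open>p + q * \<surd>k\<close> of norm
  \<open>b^2 * (-e)^n / e^(2 * m)\<close>, which is \<open>c^2\<close> for even \<open>n\<close> and
  \<open>-e\<close> for odd \<open>n\<close>.\<close>

lemma pow_ratio_small_norm:
  fixes d k :: int
  assumes "k - d\<^sup>2 \<noteq> 0" and "k - d\<^sup>2 dvd 4 * d\<^sup>2" and Q: "pow_irr d k n \<noteq> 0"
  obtains p q :: int where "q \<noteq> 0" and "\<bar>p\<^sup>2 - k * q\<^sup>2\<bar> \<le> \<bar>k - d\<^sup>2\<bar>"
    and "of_int (pow_rat d k n) / of_int (pow_irr d k n) = (of_int p / of_int q :: real)"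
proof -
  define e where "e = k - d\<^sup>2"
  have "e \<noteq> 0" "e dvd (2 * d)\<^sup>2"
    using assms unfolding e_def by (simp_all add: power_mult_distrib)
  then obtain c where c: "c \<noteq> 0" "c\<^sup>2 \<le> \<bar>e\<bar>" "e dvd c * (2 * d)"
    by (rule obtain_small_cofactor)
  define m where "m = n div 2"
  define b where "b = (if even n then c else 1)"
  have n: "n = (if even n then 2 * m else 1 + 2 * m)"
    unfolding m_def by auto
  have "e ^ m dvd b * pow_rat d k n" "e ^ m dvd b * pow_irr d k n"
    using pow_even_dvd[OF assms(2), of c m] pow_odd_dvd[OF assms(2), of m] c(3) n
    unfolding b_def e_def by (metis mult_1)+
  then obtain p q where p: "b * pow_rat d k n = e ^ m * p" and q: "b * pow_irr d k n = e ^ m * q"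
    by (meson dvdE)
  have "b \<noteq> 0"
    using c(1) unfolding b_def by simp
  show thesis
  proof
    show "q \<noteq> 0"
      using q Q \<open>b \<noteq> 0\<close> by auto
    have "(e ^ m)\<^sup>2 * (p\<^sup>2 - k * q\<^sup>2) = (e ^ m * p)\<^sup>2 - k * (e ^ m * q)\<^sup>2"
      by (simp add: algebra_simps power_mult_distrib)
    also have "\<dots> = b\<^sup>2 * ((pow_rat d k n)\<^sup>2 - k * (pow_irr d k n)\<^sup>2)"
      unfolding p[symmetric] q[symmetric] by (simp add: algebra_simps power_mult_distrib)
    also have "\<dots> = b\<^sup>2 * (- e) ^ n"
      unfolding pow_norm e_def by simp
    also have "\<dots> = (e ^ m)\<^sup>2 * (if even n then c\<^sup>2 else - e)"
    proof (cases "even n")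
      case True
      then have "(- e) ^ n = (e ^ m)\<^sup>2"
        using n power_even_eq[of e m] by simp
      then show ?thesis
        using True unfolding b_def by simp
    next
      case False
      then have "n = Suc (2 * m)"
        using n by simp
      then have "(- e) ^ n = - e * (e ^ m)\<^sup>2"
        using power_even_eq[of e m] by simp
      then show ?thesis
        using False unfolding b_def by simp
    qed
    finally have "p\<^sup>2 - k * q\<^sup>2 = (if even n then c\<^sup>2 else - e)"
      using \<open>e \<noteq> 0\<close> by simp
    then show "\<bar>p\<^sup>2 - k * q\<^sup>2\<bar> \<le> \<bar>k - d\<^sup>2\<bar>"
      using c(2) unfolding e_def by auto
    have "real_of_int (pow_rat d k n) / of_int (pow_irr d k n) =
        of_int (b * pow_rat d k n) / of_int (b * pow_irr d k n)"
      using \<open>b \<noteq> 0\<close> by simp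
    then show "of_int (pow_rat d k n) / of_int (pow_irr d k n) = (of_int p / of_int q :: real)"
      unfolding p q using \<open>e \<noteq> 0\<close> by simp
  qed
qed

section \<open>From small norm to good approximation\<close>

text \<open>For positive \<open>q\<close> and \<open>x = \<surd>k\<close>, the product
  \<open>|q * x - p| * (q * x + p)\<close> is the absolute norm, at most
  \<open>2 * h < x + h\<close>, while \<open>q * x + p \<ge> q * (x + h)\<close>. Hence
  \<open>|q * x - p| * q < 1\<close>.\<close>

lemma semiconvergent_if_small_norm:
  fixes p q k :: int and h :: real
  assumes irr: "sqrt (of_int k) \<notin> \<rat>" and "k > 0" and "q \<noteq> 0"
    and h: "h < sqrt (of_int k)" "h \<le> of_int p / of_int q"
    and norm: "of_int \<bar>p\<^sup>2 - k * q\<^sup>2\<bar> \<le> 2 * h"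
  shows "semiconvergent (sqrt (of_int k)) (of_int p / of_int q)"
proof -
  define x where "x = sqrt (of_int k)"
  have x: "x\<^sup>2 = of_int k" "x > 0"
    using \<open>k > 0\<close> unfolding x_def by auto
  \<comment> \<open>Both \<open>p\<close> and \<open>q\<close> may be negative; making the
    denominator positive changes neither the quotient nor the norm.\<close>
  define p' q' where "p' = sgn q * p" and "q' = \<bar>q\<bar>"
  have ratio: "real_of_int p / of_int q = of_int p' / of_int q'"
    using \<open>q \<noteq> 0\<close> unfolding p'_def q'_def by (cases "q > 0") auto
  have norm_eq: "p'\<^sup>2 - k * q'\<^sup>2 = p\<^sup>2 - k * q\<^sup>2"
    using \<open>q \<noteq> 0\<close> unfolding p'_def q'_def by (cases "q > 0") auto
  have "q' \<ge> 1"
    using \<open>q \<noteq> 0\<close> unfolding q'_def by simp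
  have p': "h * of_int q' \<le> of_int p'"
    using h(2) \<open>q' \<ge> 1\<close> unfolding ratio by (simp add: field_simps)
  have "h \<ge> 0"
    using norm by linarith
  then have "0 \<le> h * of_int q'"
    using \<open>q' \<ge> 1\<close> by simp
  then have "0 \<le> of_int q' * x + of_int p'"
    using p' x \<open>q' \<ge> 1\<close> by simp
  define D where "D = \<bar>of_int q' * x - of_int p'\<bar>"
  have "D * (of_int q' * x + of_int p') = \<bar>(of_int q' * x - of_int p') * (of_int q' * x + of_int p')\<bar>"
    using \<open>0 \<le> of_int q' * x + of_int p'\<close> unfolding D_def by (simp add: abs_mult)
  also have "(of_int q' * x - of_int p') * (of_int q' * x + of_int p') =
      of_int (- (p'\<^sup>2 - k * q'\<^sup>2))"
    by (simp add: algebra_simps flip: x(1)) (simp add: power2_eq_square algebra_simps)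
  also have "\<bar>of_int (- (p'\<^sup>2 - k * q'\<^sup>2))\<bar> \<le> 2 * h"
    using norm unfolding norm_eq by simp
  finally have D: "D * (of_int q' * x + of_int p') \<le> 2 * h" .
  have "D * of_int q' < 1"
  proof (rule ccontr)
    assume "\<not> D * of_int q' < 1"
    then have "1 * (x + h) \<le> (D * of_int q') * (x + h)"
      using x \<open>h \<ge> 0\<close> by (intro mult_right_mono) auto
    also have "\<dots> = D * (of_int q' * x + h * of_int q')"
      by (simp add: algebra_simps)
    also have "\<dots> \<le> D * (of_int q' * x + of_int p')"
      using p' unfolding D_def by (intro mult_left_mono) auto
    also note D
    finally show False
      using h(1) unfolding x_def by simp
  qed
  then show ?thesis
    unfolding ratio x_def[symmetric] D_def
    using semiconvergent_if_close[of x q' p'] irr x \<open>q' \<ge> 1\<close> unfolding x_def by blast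
qed

lemma sqrt_nat_irrational:
  assumes "\<not> is_square (k :: nat)"
  shows "sqrt (real k) \<notin> \<rat>"
proof
  assume "sqrt (real k) \<in> \<rat>"
  then obtain m n :: nat where mn: "n \<noteq> 0" "\<bar>sqrt (real k)\<bar> = real m / real n" "coprime m n"
    by (rule Rats_abs_nat_div_natE)
  then have "sqrt (real k) * real n = real m"
    by simp
  then have "(sqrt (real k) * real n)\<^sup>2 = (real m)\<^sup>2"
    by simp
  then have "real (k * n\<^sup>2) = real (m\<^sup>2)"
    by (simp add: power_mult_distrib)
  then have "k * n\<^sup>2 = m\<^sup>2"
    by (simp only: of_nat_eq_iff)
  then have "n dvd m"
    by (metis dvd_triv_right pow_divides_pow_iff zero_less_numeral pos2)
  then have "n = 1"
    using mn(3) by (metis coprime_absorb_right nat_dvd_1_iff_1)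
  then show False
    using \<open>k * n\<^sup>2 = m\<^sup>2\<close> assms by simp
qed

theorem theorem2p6:
  fixes k :: nat and d :: int and R :: real
  assumes "k > 0"
    and "\<not> is_square k"
    and "d = \<lfloor>sqrt (real k)\<rfloor> \<or> d = \<lceil>sqrt (real k)\<rceil>"
    and "R = 4 * (of_int d)\<^sup>2 / (real k - (of_int d)\<^sup>2)"
    and "R \<in> \<int>"
  shows "\<forall>n\<ge>1. \<exists>r. (sqrt_map (of_int d) (real k) ^^ n) None = Some r \<and>
                   semiconvergent (sqrt (real k)) r"
proof (intro allI impI)
  fix n :: nat
  assume "n \<ge> 1"
  then obtain i where i: "n = Suc i"
    by (metis One_nat_def Suc_le_D)
  define x where "x = sqrt (real k)"
  define K where "K = int k"
  define h where "h = \<lfloor>x\<rfloor>"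
  define e where "e = K - d\<^sup>2"
  have irr: "x \<notin> \<rat>"
    unfolding x_def by (rule sqrt_nat_irrational[OF assms(2)])
  then have "x \<noteq> of_int h"
    by (metis Rats_of_int)
  then have h: "of_int h < x" "x < of_int h + 1"
    unfolding h_def by linarith+
  have x2: "x\<^sup>2 = of_int K"
    unfolding x_def K_def by simp
  have "x \<ge> 1"
    using assms(1) unfolding x_def by simp
  then have "h \<ge> 1"
    unfolding h_def by linarith
  have d: "d = h \<or> d = h + 1"
    using assms(3) \<open>x \<noteq> of_int h\<close> unfolding x_def[symmetric] h_def by (auto simp: ceiling_altdef)
  have "(of_int h)\<^sup>2 < x\<^sup>2" "x\<^sup>2 < (of_int h + 1)\<^sup>2"
    using h \<open>h \<ge> 1\<close> \<open>x \<ge> 1\<close> by (intro power_strict_mono; simp)+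
  then have "real_of_int (h\<^sup>2) < of_int K" "real_of_int K < of_int ((h + 1)\<^sup>2)"
    unfolding x2 by simp_all
  then have K: "h\<^sup>2 < K" "K < (h + 1)\<^sup>2"
    by (simp_all only: of_int_less_iff)
  \<comment> \<open>Since \<open>K\<close> lies strictly between consecutive squares,
    \<open>0 < e \<le> 2 * h\<close> for \<open>d = h\<close>, and \<open>-2 * h \<le> e < 0\<close>
    for \<open>d = h + 1\<close>.\<close>
  have e: "e \<noteq> 0" "\<bar>e\<bar> \<le> 2 * h"
    using d K unfolding e_def by (auto simp: power2_eq_square algebra_simps)
  have "d \<ge> 1" "K \<ge> 1"
    using d \<open>h \<ge> 1\<close> assms(1) unfolding K_def by auto
  obtain r where "R = of_int r"
    using assms(5) by (rule Ints_cases)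
  have "real k - (of_int d)\<^sup>2 = of_int e"
    unfolding e_def K_def by simp
  then have "real_of_int (e * r) = of_int (4 * d\<^sup>2)"
    using assms(4) e(1) \<open>R = of_int r\<close> by (simp add: field_simps)
  then have "e dvd 4 * d\<^sup>2"
    by (metis dvd_triv_left of_int_eq_iff)
  have Q: "pow_irr d K n \<ge> 1"
    using pow_pos(2)[OF \<open>d \<ge> 1\<close> \<open>K \<ge> 1\<close>] unfolding i .
  then have "pow_irr d K n \<noteq> 0"
    by simp
  with e(1) \<open>e dvd 4 * d\<^sup>2\<close> obtain p q :: int where pq: "q \<noteq> 0" "\<bar>p\<^sup>2 - K * q\<^sup>2\<bar> \<le> \<bar>e\<bar>"
    and ratio: "of_int (pow_rat d K n) / of_int (pow_irr d K n) = (of_int p / of_int q :: real)"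
    unfolding e_def by (rule pow_ratio_small_norm)
  have "h * pow_irr d K n \<le> pow_rat d K n"
    using pow_ratio_ge[of h d K n] \<open>h \<ge> 1\<close> d K(1) by simp
  then have "of_int h * real_of_int (pow_irr d K n) \<le> of_int (pow_rat d K n)"
    by (metis of_int_le_iff of_int_mult)
  then have "of_int h \<le> real_of_int (pow_rat d K n) / of_int (pow_irr d K n)"
    using Q by (simp add: field_simps)
  then have hpq: "of_int h \<le> real_of_int p / of_int q"
    unfolding ratio .
  have "of_int \<bar>p\<^sup>2 - K * q\<^sup>2\<bar> \<le> 2 * real_of_int h"
    using pq(2) e(2) by linarith
  with semiconvergent_if_small_norm[of K q "of_int h" p]
  have "semiconvergent x (of_int p / of_int q)"
    using irr h(1) hpq pq(1) \<open>K \<ge> 1\<close> unfolding x_def K_def by simp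
  moreover have "(sqrt_map (of_int d) (real k) ^^ n) None = Some (of_int p / of_int q)"
    using sqrt_map_iterate[OF \<open>d \<ge> 1\<close> \<open>K \<ge> 1\<close>, of i] unfolding i[symmetric] ratio
    by (simp add: K_def)
  ultimately show "\<exists>r. (sqrt_map (of_int d) (real k) ^^ n) None = Some r \<and>
      semiconvergent (sqrt (real k)) r"
    unfolding x_def by blast
qed

end
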